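(* Let $d$ be a degree sequence and let $\mathcal{P}(d)$ be the subgraph of the realization graph $\mathcal{G}(d)$ induced by the pseudoforests with degree sequence $d$. Then $\mathcal{P}(d)$ is connected; i.e., any two pseudoforests on $\{1,\dots,n\}$ with the same degree sequence can be transformed into one another by a sequence of 2-switches all of whose intermediate graphs are pseudoforests.
   Context: All graphs are finite and simple. A pseudoforest is a graph each of whose connected components is a tree or a unicyclic graph (connected with exactly one cycle). A 2-switch on $G$ is specified by four distinct vertices $a,b,c,d$ with $ab,cd\in E(G)$ and $ac,bd\notin E(G)$; it produces $G-ab-cd+ac+bd$. The realization graph $\mathcal{G}(d)$ has as vertices all graphs on $\{1,\dots,n\}$ with degree sequence $d$, adjacent when one is obtained from the other by a single 2-switch. *)

theory Defs
  imports "Graph_Theory.Graph_Theory"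
begin

text \<open>
  A finite simple graph is a \<^locale>\<open>pair_graph\<close>: a finite, loopless, symmetric digraph without
  parallel arcs, in which the undirected edge \<open>uv\<close> is the pair of arcs \<open>(u, v)\<close>, \<open>(v, u)\<close>.
  Because of the symmetry its strongly connected components \<open>sccs\<close> are its connected components
  (as induced subgraphs), and the out-degree of a vertex is its degree.
\<close>

text \<open>
  The cycles of an undirected graph, each given by its set of undirected edges, so that
  rotations and reversals of a closed walk are identified. The bound on the length excludes the
  directed 2-cycles \<open>u, v, u\<close> that run back and forth along one undirected edge. These 2-cycles
  are also why \<^const>\<open>tree\<close> cannot be used for trees below: in a symmetric digraph it admits
  no edge at all.
\<close>

definition cycles :: "('a, 'b) pre_digraph \<Rightarrow> 'a set set set" where
  "cycles G = {(\<lambda>e. {tail G e, head G e}) ` set p | p. pre_digraph.cycle G p \<and> 3 \<le> length p}"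

definition is_tree :: "('a, 'b) pre_digraph \<Rightarrow> bool" where
  "is_tree G \<longleftrightarrow> connected G \<and> cycles G = {}"

definition unicyclic :: "('a, 'b) pre_digraph \<Rightarrow> bool" where
  "unicyclic G \<longleftrightarrow> connected G \<and> (\<exists>!C. C \<in> cycles G)"

definition pseudoforest :: "'a pair_pre_digraph \<Rightarrow> bool" where
  "pseudoforest G \<longleftrightarrow> pair_graph G \<and>
     (\<forall>K \<in> pre_digraph.sccs (with_proj G). is_tree K \<or> unicyclic K)"

definition two_switch :: "'a pair_pre_digraph \<Rightarrow> 'a pair_pre_digraph \<Rightarrow> bool" where
  "two_switch G H \<longleftrightarrow> (\<exists>a b c d. distinct [a, b, c, d] \<and>
     (a, b) \<in> parcs G \<and> (c, d) \<in> parcs G \<and> (a, c) \<notin> parcs G \<and> (b, d) \<notin> parcs G \<and>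
     H = \<lparr> pverts = pverts G,
           parcs = (parcs G - {(a, b), (b, a), (c, d), (d, c)})
                     \<union> {(a, c), (c, a), (b, d), (d, b)} \<rparr>)"

text \<open>
  A sequence \<open>d\<^sub>1, \<dots>, d\<^sub>n\<close> is a function \<open>d\<close> of which only the values on \<open>{1..n}\<close> matter.
\<close>

definition realizations :: "nat \<Rightarrow> (nat \<Rightarrow> nat) \<Rightarrow> nat pair_pre_digraph set" where
  "realizations n d =
     {G. pair_graph G \<and> pverts G = {1..n} \<and> (\<forall>v \<in> {1..n}. out_degree (with_proj G) v = d v)}"

definition degree_sequence :: "nat \<Rightarrow> (nat \<Rightarrow> nat) \<Rightarrow> bool" where
  "degree_sequence n d \<longleftrightarrow> realizations n d \<noteq> {}"

definition realization_graph :: "nat \<Rightarrow> (nat \<Rightarrow> nat) \<Rightarrow> nat pair_pre_digraph pair_pre_digraph" where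
  "realization_graph n d =
     \<lparr> pverts = realizations n d,
       parcs = {(G, H). G \<in> realizations n d \<and> H \<in> realizations n d \<and>
                        (two_switch G H \<or> two_switch H G)} \<rparr>"

text \<open>
  It may have no vertices, in which case \<^const>\<open>connected\<close>, which demands a vertex, is false.
\<close>

definition pseudoforest_graph ::
  "nat \<Rightarrow> (nat \<Rightarrow> nat) \<Rightarrow>
     (nat pair_pre_digraph, nat pair_pre_digraph \<times> nat pair_pre_digraph) pre_digraph" where
  "pseudoforest_graph n d =
     with_proj (realization_graph n d) \<restriction> {G \<in> realizations n d. pseudoforest G}"

end

theory Submission
  imports Defs
begin

text \<open>
  A graph is a pseudoforest iff every edge can be assigned to one of its endpoints such that no
  vertex receives two edges, i.e. iff some \<open>f\<close> satisfies \<open>f x = y\<close> or \<open>f y = x\<close> for every edge \<open>xy\<close>.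
  In a pseudoforest such an \<open>f\<close> arises by adding the edges one at a time: one end of the new edge
  lies in a component without a cycle and is freed by reversing the arrows that lead away from it.

  Two pseudoforests with equal degrees are joined by deleting a vertex \<open>v\<close> and using induction; for
  this, switches must first give \<open>v\<close> the same neighbours in both graphs, and putting \<open>v\<close> back must
  preserve pseudoforests. If all degrees are at most 2, every realization is a pseudoforest and any
  \<open>v\<close> will do. Otherwise fix a vertex \<open>w\<close> of degree at least 3; as there are at most as many edges
  as vertices, there is a leaf \<open>v\<close>, and in either graph one switch makes \<open>v\<close> a neighbour of \<open>w\<close>.
\<close>

section \<open>Circuits\<close>

text \<open>
  A directed cycle is given by the set of its arcs. Asymmetry excludes loops and the 2-cycles
  \<open>u, v, u\<close>, so that every circuit of a symmetric relation is a cycle of the undirected graph.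
\<close>

definition circuit :: "'a rel \<Rightarrow> bool" where
  "circuit C \<longleftrightarrow> C \<noteq> {} \<and> single_valued C \<and> single_valued (C\<inverse>) \<and> asym C \<and>
     Domain C = Range C \<and> (\<forall>x \<in> Domain C. \<forall>y \<in> Domain C. (x, y) \<in> C\<^sup>*)"

lemma
  assumes "circuit C"
  shows circuit_nonempty: "Domain C \<noteq> {}"
    and circuit_successor_unique: "(x, y) \<in> C \<Longrightarrow> (x, z) \<in> C \<Longrightarrow> y = z"
    and circuit_asym: "(x, y) \<in> C \<Longrightarrow> (y, x) \<notin> C"
    and circuit_Domain_eq_Range: "Domain C = Range C"
    and circuit_connected: "x \<in> Domain C \<Longrightarrow> y \<in> Domain C \<Longrightarrow> (x, y) \<in> C\<^sup>*"
  using assms by (auto simp: circuit_def single_valued_def dest: asymD)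

lemma circuit_converse: "circuit C \<Longrightarrow> circuit (C\<inverse>)"
  unfolding circuit_def by (auto simp: rtrancl_converse asym_on_def)

lemma circuit_subset_imp_eq:
  assumes C: "circuit C" and D: "circuit D" and "D \<subseteq> C"
  shows "D = C"
proof -
  have next_arc: "(x, y) \<in> D" if "(x, y) \<in> C" "x \<in> Domain D" for x y
    using that \<open>D \<subseteq> C\<close> circuit_successor_unique[OF C] by blast
  hence "C `` Domain D \<subseteq> Domain D" using circuit_Domain_eq_Range[OF D] by blast
  hence "C\<^sup>* `` Domain D = Domain D" by (rule Image_closed_trancl)
  moreover obtain x where "x \<in> Domain D" using circuit_nonempty[OF D] by blast
  ultimately have "Domain C \<subseteq> Domain D" using circuit_connected[OF C, of x] \<open>D \<subseteq> C\<close> by blast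
  hence "C \<subseteq> D" using next_arc by auto
  with \<open>D \<subseteq> C\<close> show ?thesis by simp
qed

definition edge_set :: "'a rel \<Rightarrow> 'a set set" where
  "edge_set R = (\<lambda>e. {fst e, snd e}) ` R"

lemma mem_edge_set_iff: "{x, y} \<in> edge_set R \<longleftrightarrow> (x, y) \<in> R \<or> (y, x) \<in> R"
  by (force simp: edge_set_def doubleton_eq_iff)

lemma edge_set_converse: "edge_set (R\<inverse>) = edge_set R"
  by (force simp: edge_set_def)

lemma map_fst_pcas: "pcas u p v \<Longrightarrow> map fst p @ [v] = u # map snd p"
  by (induction p arbitrary: u) auto

lemma pcas_append_iff: "pcas u (p @ q) v \<longleftrightarrow> (\<exists>w. pcas u p w \<and> pcas w q v)"
  by (induction p arbitrary: u) auto

lemma pcas_imp_rtrancl: "pcas u p v \<Longrightarrow> (u, v) \<in> (set p)\<^sup>*"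
proof (induction p arbitrary: u)
  case (Cons e p)
  hence "(u, snd e) \<in> set (e # p)" "(snd e, v) \<in> (set p)\<^sup>*" by auto
  moreover have "(set p)\<^sup>* \<subseteq> (set (e # p))\<^sup>*" by (rule rtrancl_mono) auto
  ultimately show ?case by (blast intro: converse_rtrancl_into_rtrancl)
qed simp

lemma pcas_rtrancl_fst:
  assumes "pcas u p v" "e \<in> set p"
  shows "(u, fst e) \<in> (set p)\<^sup>*" "(fst e, v) \<in> (set p)\<^sup>*"
proof -
  obtain q r where p: "p = q @ e # r" using assms(2) by (auto dest: split_list)
  hence "pcas u q (fst e)" "pcas (fst e) (e # r) v" using assms(1) by (auto simp: pcas_append_iff)
  moreover have "set q \<subseteq> set p" "set (e # r) \<subseteq> set p" by (auto simp: p)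
  ultimately show "(u, fst e) \<in> (set p)\<^sup>*" "(fst e, v) \<in> (set p)\<^sup>*"
    by (meson pcas_imp_rtrancl rtrancl_mono subsetD)+
qed

lemma circuit_set_pcas:
  assumes p: "pcas u p u" "distinct (map snd p)" "3 \<le> length p"
  shows "circuit (set p)"
proof -
  have "mset (map fst p) = mset (map snd p)"
    using arg_cong[OF map_fst_pcas[OF p(1)], of mset] by simp
  hence distinct_fst: "distinct (map fst p)" and fst_eq_snd: "fst ` set p = snd ` set p"
    using p(2) by (metis mset_eq_imp_distinct_iff, metis mset_eq_setD set_map)
  have functional: "single_valued (set p)" "single_valued ((set p)\<inverse>)"
    using distinct_fst p(2) by (fastforce simp: distinct_map inj_on_def single_valued_def)+
  have mutual: "(fst e, fst e') \<in> (set p)\<^sup>*" if "e \<in> set p" "e' \<in> set p" for e e'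
    using that pcas_rtrancl_fst[OF p(1)] by (blast intro: rtrancl_trans)
  show ?thesis
    unfolding circuit_def
  proof (intro conjI ballI asymI)
    show "set p \<noteq> {}" using p(3) by auto
    show "Domain (set p) = Range (set p)" using fst_eq_snd by (simp add: Domain_fst Range_snd)
    fix x y
    assume "x \<in> Domain (set p)" "y \<in> Domain (set p)"
    thus "(x, y) \<in> (set p)\<^sup>*" using mutual by (auto simp: Domain_fst)
  next
    fix x y
    assume xy: "(x, y) \<in> set p"
    show "(y, x) \<notin> set p"
    proof
      assume "(y, x) \<in> set p"
      hence "set p `` {x, y} \<subseteq> {x, y}" using xy functional by (auto simp: single_valued_def)
      hence closed: "(set p)\<^sup>* `` {x, y} = {x, y}" by (rule Image_closed_trancl)
      have "fst ` set p \<subseteq> (set p)\<^sup>* `` {x, y}" using mutual[OF xy] by auto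
      also note closed
      finally have "card (fst ` set p) \<le> card {x, y}" by (intro card_mono) auto
      also have "\<dots> \<le> 2" by (simp add: card_insert_if)
      finally show False using p(3) distinct_card[OF distinct_fst] by simp
    qed
  qed (fact functional)+
qed

lemma pawalk_verts_pcas: "pcas u p v \<Longrightarrow> pawalk_verts u p = u # map snd p"
  by (induction p arbitrary: u) auto

lemma rtrancl_imp_distinct_pcas:
  assumes "(u, v) \<in> S\<^sup>*"
  obtains p where "pcas u p v" "set p \<subseteq> S" "distinct (u # map snd p)"
proof -
  define G where "G = \<lparr>pverts = UNIV, parcs = S\<rparr>"
  interpret pair_wf_digraph G by unfold_locales (simp_all add: G_def)
  have "u \<rightarrow>\<^sup>*\<^bsub>with_proj G\<^esub> v" using assms reachable_conv'[of u v] by (simp add: G_def)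
  then obtain p where "apath u p v" unfolding reachable_apath by blast
  hence p: "pcas u p v" "set p \<subseteq> parcs G" "distinct (pawalk_verts u p)"
    by (auto simp: apath_def awalk_def)
  show ?thesis using that[OF p(1)] p(2,3) by (simp add: G_def pawalk_verts_pcas[OF p(1)])
qed

lemma closed_walk_through_arc:
  assumes "(v, u) \<in> S\<^sup>*" "u \<noteq> v" "(v, u) \<notin> S"
  obtains p where "pcas u p u" "distinct (map snd p)" "3 \<le> length p"
    "(u, v) \<in> set p" "set p \<subseteq> insert (u, v) S"
proof -
  obtain q where q: "pcas v q u" "set q \<subseteq> S" "distinct (v # map snd q)"
    using rtrancl_imp_distinct_pcas[OF assms(1)] .
  have "2 \<le> length q"
  proof (cases q rule: remdups_adj.cases)
    case (2 e)
    thus ?thesis using q assms(3) by (cases e) auto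
  qed (use q assms in auto)
  thus ?thesis using q by (intro that[of "(u, v) # q"]) auto
qed

lemma circuit_through_arc:
  assumes "(v, u) \<in> S\<^sup>*" "u \<noteq> v" "(v, u) \<notin> S"
  obtains C where "circuit C" "(u, v) \<in> C" "C \<subseteq> insert (u, v) S"
proof -
  obtain p where "pcas u p u" "distinct (map snd p)" "3 \<le> length p"
    "(u, v) \<in> set p" "set p \<subseteq> insert (u, v) S"
    using closed_walk_through_arc[OF assms] .
  thus ?thesis using circuit_set_pcas[of u p] that by blast
qed

lemma cycle_with_proj_iff:
  assumes "parcs K \<subseteq> pverts K \<times> pverts K"
  shows "pre_digraph.cycle (with_proj K) p \<longleftrightarrow>
    set p \<subseteq> parcs K \<and> p \<noteq> [] \<and> distinct (map snd p) \<and> (\<exists>u. pcas u p u)"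
proof -
  have "u \<in> pverts K" if "pcas u p u" "p \<noteq> []" "set p \<subseteq> parcs K" for u
    using that assms by (cases p) auto
  thus ?thesis
    unfolding pre_digraph.cycle_def pre_digraph.awalk_def cas_with_proj_eq
      awalk_verts_with_proj_eq with_proj_simps
    by (auto simp: pawalk_verts_pcas cong: conj_cong)
qed

lemma cycles_with_proj:
  assumes "parcs K \<subseteq> pverts K \<times> pverts K"
  shows "cycles (with_proj K) = {edge_set C | C. circuit C \<and> C \<subseteq> parcs K}"
proof (intro equalityI subsetI)
  fix E assume "E \<in> cycles (with_proj K)"
  then obtain p where p: "pre_digraph.cycle (with_proj K) p" "3 \<le> length p" "E = edge_set (set p)"
    by (auto simp: cycles_def edge_set_def)
  hence "circuit (set p)" "set p \<subseteq> parcs K"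
    using circuit_set_pcas[of _ p] by (auto simp: cycle_with_proj_iff[OF assms])
  thus "E \<in> {edge_set C | C. circuit C \<and> C \<subseteq> parcs K}" using p(3) by blast
next
  fix E assume "E \<in> {edge_set C | C. circuit C \<and> C \<subseteq> parcs K}"
  then obtain C where C: "circuit C" "C \<subseteq> parcs K" and E: "E = edge_set C" by blast
  obtain x y where xy: "(x, y) \<in> C" using circuit_nonempty[OF C(1)] by blast
  have "(y, x) \<in> C\<^sup>*" using xy circuit_Domain_eq_Range[OF C(1)] circuit_connected[OF C(1)] by blast
  moreover have "(y, x) \<notin> C" "x \<noteq> y" using xy circuit_asym[OF C(1)] by blast+
  ultimately obtain p where p: "pcas x p x" "distinct (map snd p)" "3 \<le> length p" "set p \<subseteq> C"
    using closed_walk_through_arc xy by (metis insert_absorb)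
  have "set p = C" using circuit_subset_imp_eq[OF C(1) circuit_set_pcas[OF p(1-3)] p(4)] .
  moreover have "pre_digraph.cycle (with_proj K) p"
    using p C(2) by (auto simp: cycle_with_proj_iff[OF assms])
  ultimately show "E \<in> cycles (with_proj K)" using p(3) by (auto simp: cycles_def E edge_set_def)
qed

lemma cycles_induce_subgraph:
  "cycles (with_proj G \<restriction> V) = {edge_set C | C. circuit C \<and> C \<subseteq> parcs G \<and> Domain C \<subseteq> V}"
proof -
  define K where "K = \<lparr>pverts = V, parcs = Restr (parcs G) V\<rparr>"
  have "with_proj G \<restriction> V = with_proj K"
    by (auto simp: induce_subgraph_def with_proj_def K_def)
  moreover have "circuit C \<and> C \<subseteq> parcs K \<longleftrightarrow> circuit C \<and> C \<subseteq> parcs G \<and> Domain C \<subseteq> V" for C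
    using circuit_Domain_eq_Range[of C] by (auto simp: K_def)
  moreover have "parcs K \<subseteq> pverts K \<times> pverts K" by (simp add: K_def)
  ultimately show ?thesis using cycles_with_proj[of K] by simp
qed

section \<open>Pseudoforests\<close>

definition simple :: "'a rel \<Rightarrow> bool" where
  "simple R \<longleftrightarrow> finite R \<and> sym R \<and> irrefl R"

lemma
  assumes "simple R"
  shows simple_imp_finite: "finite R"
    and simple_imp_sym: "sym R"
    and simple_symD: "(x, y) \<in> R \<Longrightarrow> (y, x) \<in> R"
    and simple_irrefl: "(x, x) \<notin> R"
    and simple_finite_Image: "finite (R `` A)"
  using assms by (auto simp: simple_def irrefl_def finite_Image dest: symD)

lemma simple_rtrancl_sym: "simple R \<Longrightarrow> (x, y) \<in> R\<^sup>* \<Longrightarrow> (y, x) \<in> R\<^sup>*"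
  using simple_imp_sym sym_rtrancl symD by metis

lemma pair_graph_iff_simple:
  "pair_graph G \<longleftrightarrow> finite (pverts G) \<and> parcs G \<subseteq> pverts G \<times> pverts G \<and> simple (parcs G)"
proof
  assume "pair_graph G"
  then interpret pair_graph G .
  have "sym (parcs G)" using pair_sym_arcs by (simp add: symmetric_def)
  moreover have "irrefl (parcs G)" using pair_no_loops by (force simp: irrefl_def)
  ultimately show "finite (pverts G) \<and> parcs G \<subseteq> pverts G \<times> pverts G \<and> simple (parcs G)"
    using pair_finite_verts pair_finite_arcs in_arcsD1 in_arcsD2 by (auto simp: simple_def)
next
  assume "finite (pverts G) \<and> parcs G \<subseteq> pverts G \<times> pverts G \<and> simple (parcs G)"
  thus "pair_graph G"
    by unfold_locales (auto simp: simple_def irrefl_def symmetric_def)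
qed

definition circuit_unique :: "'a rel \<Rightarrow> bool" where
  "circuit_unique R \<longleftrightarrow>
     (\<forall>C D x y. circuit C \<and> C \<subseteq> R \<and> circuit D \<and> D \<subseteq> R \<and> x \<in> Domain C \<and> y \<in> Domain D \<and>
        (x, y) \<in> R\<^sup>* \<longrightarrow> edge_set C = edge_set D)"

lemma circuit_unique_subset:
  assumes "circuit_unique R" "S \<subseteq> R"
  shows "circuit_unique S"
  using assms rtrancl_mono[OF assms(2)] unfolding circuit_unique_def
  by (meson subset_trans subsetD)

lemma circuit_unique_iff_components:
  assumes R: "simple R" "R \<subseteq> V \<times> V"
  shows "circuit_unique R \<longleftrightarrow>
    (\<forall>u \<in> V. \<forall>C D. circuit C \<and> C \<subseteq> R \<and> Domain C \<subseteq> R\<^sup>* `` {u} \<and>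
       circuit D \<and> D \<subseteq> R \<and> Domain D \<subseteq> R\<^sup>* `` {u} \<longrightarrow> edge_set C = edge_set D)"
    (is "_ \<longleftrightarrow> ?unique")
proof
  assume unique: "circuit_unique R"
  show ?unique
  proof (intro ballI allI impI, elim conjE)
    fix u C D
    assume C: "circuit C" "C \<subseteq> R" "Domain C \<subseteq> R\<^sup>* `` {u}"
      and D: "circuit D" "D \<subseteq> R" "Domain D \<subseteq> R\<^sup>* `` {u}"
    obtain x y where x: "x \<in> Domain C" and y: "y \<in> Domain D"
      using circuit_nonempty[OF C(1)] circuit_nonempty[OF D(1)] by blast
    hence "(u, x) \<in> R\<^sup>*" "(u, y) \<in> R\<^sup>*" using C(3) D(3) by blast+
    hence "(x, y) \<in> R\<^sup>*" using simple_rtrancl_sym[OF R(1)] by (blast intro: rtrancl_trans)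
    thus "edge_set C = edge_set D"
      using unique C(1,2) D(1,2) x y unfolding circuit_unique_def by blast
  qed
next
  assume unique: ?unique
  show "circuit_unique R"
    unfolding circuit_unique_def
  proof (intro allI impI, elim conjE)
    fix C D x y
    assume C: "circuit C" "C \<subseteq> R" "x \<in> Domain C" and D: "circuit D" "D \<subseteq> R" "y \<in> Domain D"
      and xy: "(x, y) \<in> R\<^sup>*"
    have "Domain C \<subseteq> R\<^sup>* `` {x}"
      using circuit_connected[OF C(1,3)] rtrancl_mono[OF C(2)] by blast
    moreover have "Domain D \<subseteq> R\<^sup>* `` {x}"
      using circuit_connected[OF D(1,3)] rtrancl_mono[OF D(2)] xy by (blast intro: rtrancl_trans)
    moreover have "x \<in> V" using C(2,3) R(2) by blast
    ultimately show "edge_set C = edge_set D" using unique C(1,2) D(1,2) by blast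
  qed
qed

lemma sccs_with_proj:
  assumes "pair_graph G"
  shows "pre_digraph.sccs (with_proj G) = (\<lambda>u. with_proj G \<restriction> (parcs G)\<^sup>* `` {u}) ` pverts G"
proof -
  interpret pair_graph G by fact
  have "scc_of u = (parcs G)\<^sup>* `` {u}" if "u \<in> pverts G" for u
    using reachable_conv'[OF that] symmetric_reachable' unfolding scc_of_def by blast
  thus ?thesis unfolding sccs_conv_sccs_verts sccs_verts_conv_scc_of image_image by simp
qed

lemma strongly_connected_imp_connected:
  assumes "strongly_connected G"
  shows "connected G"
  unfolding connected_conv
proof (intro conjI ballI)
  show "verts G \<noteq> {}" using assms by (simp add: strongly_connected_def)
  fix u v assume "u \<in> verts G" "v \<in> verts G"
  hence "(u, v) \<in> rtrancl_on (verts G) (arcs_ends G)"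
    using assms by (simp add: strongly_connected_def reachable_def)
  thus "(u, v) \<in> rtrancl_on (verts G) ((arcs_ends G)\<^sup>s)"
    by (rule rtrancl_on_mono[rotated 2]) (auto simp: symcl_def)
qed

lemma pseudoforest_iff_circuit_unique:
  "pseudoforest G \<longleftrightarrow> pair_graph G \<and> circuit_unique (parcs G)"
proof (cases "pair_graph G")
  case True
  let ?K = "\<lambda>u. with_proj G \<restriction> (parcs G)\<^sup>* `` {u}"
  have "connected K" if "K \<in> pre_digraph.sccs (with_proj G)" for K
    using that by (auto simp: pre_digraph.sccs_def intro: strongly_connected_imp_connected)
  hence "is_tree K \<or> unicyclic K \<longleftrightarrow> (\<forall>A \<in> cycles K. \<forall>B \<in> cycles K. A = B)"
    if "K \<in> pre_digraph.sccs (with_proj G)" for K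
    using that unfolding is_tree_def unicyclic_def by blast
  hence "pseudoforest G \<longleftrightarrow> (\<forall>u \<in> pverts G. \<forall>A \<in> cycles (?K u). \<forall>B \<in> cycles (?K u). A = B)"
    using True by (simp add: pseudoforest_def sccs_with_proj)
  also have "\<dots> \<longleftrightarrow> circuit_unique (parcs G)"
    using True circuit_unique_iff_components[of "parcs G" "pverts G"]
    unfolding cycles_induce_subgraph pair_graph_iff_simple by blast
  finally show ?thesis using True by simp
qed (simp add: pseudoforest_def)

section \<open>Orientations\<close>

text \<open>
  The vertex \<open>x\<close> receives the edge \<open>{x, f x}\<close>, or no edge if \<open>f x\<close> is not a neighbour of \<open>x\<close>.
\<close>

definition orients :: "('a \<Rightarrow> 'a) \<Rightarrow> 'a rel \<Rightarrow> bool" where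
  "orients f R \<longleftrightarrow> (\<forall>(x, y) \<in> R. f x = y \<or> f y = x)"

definition orientable :: "'a rel \<Rightarrow> bool" where
  "orientable R \<longleftrightarrow> (\<exists>f. orients f R)"

lemma orientsD: "orients f R \<Longrightarrow> (x, y) \<in> R \<Longrightarrow> f x = y \<or> f y = x"
  by (auto simp: orients_def)

lemma orients_subset: "orients f R \<Longrightarrow> S \<subseteq> R \<Longrightarrow> orients f S"
  by (auto simp: orients_def)

lemma orientable_subset: "orientable R \<Longrightarrow> S \<subseteq> R \<Longrightarrow> orientable S"
  unfolding orientable_def by (blast intro: orients_subset)

abbreviation arrows :: "('a \<Rightarrow> 'a) \<Rightarrow> 'a rel" where
  "arrows f \<equiv> {(x, y). f x = y}"

lemma oriented_circuit_cases:
  assumes C: "circuit C" and f: "orients f C"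
  shows "(\<forall>(x, y) \<in> C. f x = y) \<or> (\<forall>(x, y) \<in> C. f y = x)"
  \<comment> \<open>An arrow that runs forward along \<open>C\<close> forces the previous one to run forward as well.\<close>
proof (rule disjCI)
  assume "\<not> (\<forall>(x, y) \<in> C. f y = x)"
  then obtain a b where ab: "(a, b) \<in> C" "f b \<noteq> a" by blast
  have forward: "\<exists>y. (x, y) \<in> C \<and> f x = y" if "(x, a) \<in> C\<^sup>*" for x
    using that
  proof (induction rule: converse_rtrancl_induct)
    case base
    show ?case using ab orientsD[OF f ab(1)] by blast
  next
    case (step x y)
    then obtain z where "(y, z) \<in> C" "f y = z" by blast
    hence "f y \<noteq> x" using step(1) circuit_asym[OF C] by blast
    thus ?case using step(1) orientsD[OF f step(1)] by blast
  qed
  show "\<forall>(x, y) \<in> C. f x = y"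
  proof clarify
    fix x y assume xy: "(x, y) \<in> C"
    hence "(x, a) \<in> C\<^sup>*" using circuit_connected[OF C] ab(1) by blast
    thus "f x = y" using forward xy circuit_successor_unique[OF C] by blast
  qed
qed

lemma
  assumes C: "circuit C" and f: "orients f C"
  shows edge_set_oriented_circuit: "edge_set C = (\<lambda>x. {x, f x}) ` Domain C"
    and Domain_oriented_circuit: "z \<in> Domain C \<Longrightarrow> Domain C = (arrows f)\<^sup>* `` {z}"
proof -
  obtain D where D: "circuit D" "D \<subseteq> arrows f" "edge_set D = edge_set C" "Domain D = Domain C"
    using oriented_circuit_cases[OF C f]
  proof
    assume "\<forall>(x, y) \<in> C. f x = y"
    thus ?thesis using C by (intro that[of C]) auto
  next
    assume "\<forall>(x, y) \<in> C. f y = x"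
    thus ?thesis using circuit_converse[OF C] circuit_Domain_eq_Range[OF C]
      by (intro that[of "C\<inverse>"]) (auto simp: edge_set_converse)
  qed
  have "edge_set D = (\<lambda>x. {x, f x}) ` Domain D"
    using D(2) unfolding edge_set_def Domain_fst image_image by (intro image_cong) auto
  thus "edge_set C = (\<lambda>x. {x, f x}) ` Domain C" unfolding D .
  assume "z \<in> Domain C"
  hence z: "z \<in> Domain D" unfolding D .
  have "x \<in> Domain D" if "(z, x) \<in> (arrows f)\<^sup>*" for x
    using that
  proof (induction rule: rtrancl_induct)
    case (step x y)
    thus ?case using D(2) circuit_Domain_eq_Range[OF D(1)] by blast
  qed (fact z)
  moreover have "(z, x) \<in> (arrows f)\<^sup>*" if "x \<in> Domain D" for x
    using circuit_connected[OF D(1) z that] rtrancl_mono[OF D(2)] by blast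
  ultimately show "Domain C = (arrows f)\<^sup>* `` {z}" unfolding D(4)[symmetric] by blast
qed

lemma oriented_walks_meet:
  assumes f: "orients f R" and "(x, y) \<in> R\<^sup>*"
  shows "\<exists>z. (x, z) \<in> (arrows f)\<^sup>* \<and> (y, z) \<in> (arrows f)\<^sup>*"
  using assms(2)
proof (induction rule: rtrancl_induct)
  case (step y y')
  obtain z where z: "(x, z) \<in> (arrows f)\<^sup>*" "(y, z) \<in> (arrows f)\<^sup>*" using step.IH by blast
  consider (forward) "f y = y'" | (backward) "f y' = y" using orientsD[OF f step(2)] by blast
  thus ?case
  proof cases
    case forward
    show ?thesis
    proof (cases "z = y")
      case True
      hence "(x, y') \<in> (arrows f)\<^sup>*" using z(1) forward by (auto intro: rtrancl_into_rtrancl)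
      thus ?thesis by blast
    next
      case False
      hence "(y', z) \<in> (arrows f)\<^sup>*" using z(2) forward by (auto elim: converse_rtranclE)
      thus ?thesis using z(1) by blast
    qed
  next
    case backward
    hence "(y', z) \<in> (arrows f)\<^sup>*" using z(2) by (auto intro: converse_rtrancl_into_rtrancl)
    thus ?thesis using z(1) by blast
  qed
qed blast

lemma orients_imp_circuit_unique:
  assumes f: "orients f R"
  shows "circuit_unique R"
  unfolding circuit_unique_def
proof (intro allI impI, elim conjE)
  fix C D x y
  assume C: "circuit C" "C \<subseteq> R" and D: "circuit D" "D \<subseteq> R"
    and x: "x \<in> Domain C" and y: "y \<in> Domain D" and "(x, y) \<in> R\<^sup>*"
  then obtain z where z: "(x, z) \<in> (arrows f)\<^sup>*" "(y, z) \<in> (arrows f)\<^sup>*"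
    using oriented_walks_meet[OF f] by blast
  have oriented: "orients f C" "orients f D" using C(2) D(2) orients_subset[OF f] by blast+
  note Domain_C = Domain_oriented_circuit[OF C(1) oriented(1)]
    and Domain_D = Domain_oriented_circuit[OF D(1) oriented(2)]
  have "z \<in> Domain C" "z \<in> Domain D" using z Domain_C[OF x] Domain_D[OF y] by simp_all
  hence "Domain C = Domain D" using Domain_C Domain_D by metis
  thus "edge_set C = edge_set D"
    using edge_set_oriented_circuit[OF C(1) oriented(1)]
      edge_set_oriented_circuit[OF D(1) oriented(2)] by simp
qed

lemma orients_insert_edge:
  assumes R: "sym R" and f: "orients f R" and free: "(u, f u) \<notin> R"
  shows "orients (f(u := v)) (R \<union> {(u, v), (v, u)})"
proof -
  have "(f(u := v)) x = y \<or> (f(u := v)) y = x" if "(x, y) \<in> R" for x y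
    using that orientsD[OF f that] free symD[OF R that] by auto
  thus ?thesis unfolding orients_def by fastforce
qed

lemma orients_merge:
  assumes S: "simple S" and f: "orients f S" and g: "orients g S"
  shows "orients (\<lambda>x. if (v, x) \<in> S\<^sup>* then g x else f x) S"
proof -
  have "(v, x) \<in> S\<^sup>* \<longleftrightarrow> (v, y) \<in> S\<^sup>*" if "(x, y) \<in> S" for x y
    using that simple_symD[OF S that] by (meson rtrancl_into_rtrancl)
  thus ?thesis using f g by (auto simp: orients_def)
qed

definition acyclic_component :: "'a rel \<Rightarrow> 'a \<Rightarrow> bool" where
  "acyclic_component R u \<longleftrightarrow>
     (\<forall>C x. circuit C \<and> C \<subseteq> R \<and> x \<in> Domain C \<longrightarrow> (u, x) \<notin> R\<^sup>*)"

lemma acyclic_component_adjacent: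
  assumes "acyclic_component R u" "(u, v) \<in> R" "S \<subseteq> R"
  shows "acyclic_component S v"
proof -
  have "(u, x) \<in> R\<^sup>*" if "(v, x) \<in> S\<^sup>*" for x
    using that assms(2) rtrancl_mono[OF assms(3)] by (blast intro: converse_rtrancl_into_rtrancl)
  thus ?thesis using assms(1,3) unfolding acyclic_component_def by blast
qed

lemma acyclic_component_bridge:
  assumes "acyclic_component R u" "(u, v) \<in> R" "u \<noteq> v"
  shows "(v, u) \<notin> (R - {(u, v), (v, u)})\<^sup>*"
proof
  assume "(v, u) \<in> (R - {(u, v), (v, u)})\<^sup>*"
  then obtain C where "circuit C" "(u, v) \<in> C" "C \<subseteq> insert (u, v) (R - {(u, v), (v, u)})"
    using circuit_through_arc[OF _ assms(3)] by blast
  thus False using assms(1,2) unfolding acyclic_component_def by blast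
qed

lemma simple_Diff_edge: "simple R \<Longrightarrow> simple (R - {(u, v), (v, u)})"
  by (auto simp: simple_def sym_def irrefl_def)

lemma card_Diff_edge: "simple R \<Longrightarrow> (u, v) \<in> R \<Longrightarrow> card (R - {(u, v), (v, u)}) < card R"
  by (rule psubset_card_mono) (auto simp: simple_def)

lemma orients_reroot:
  assumes "simple R" "orients f R" "acyclic_component R u"
  shows "\<exists>g. orients g R \<and> (u, g u) \<notin> R"
  using assms
proof (induction "card R" arbitrary: R f u rule: less_induct)
  case less
  note R = less.prems(1) and f = less.prems(2) and acyclic = less.prems(3)
  define v where "v = f u"
  show ?case
  proof (cases "(u, v) \<in> R")
    case False
    thus ?thesis using f by (auto simp: v_def)
  next
    case True
    hence "u \<noteq> v" using simple_irrefl[OF R] by blast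
    define S where "S = R - {(u, v), (v, u)}"
    have S: "simple S" "S \<subseteq> R" using simple_Diff_edge[OF R] by (auto simp: S_def)
    have orients_S: "orients f S" using orients_subset[OF f S(2)] .
    obtain g where g: "orients g S" "(v, g v) \<notin> S"
      using less.hyps[OF _ S(1) orients_S acyclic_component_adjacent[OF acyclic True S(2)]]
        card_Diff_edge[OF R True] by (auto simp: S_def)
    have orients_S': "orients (f(u := u)) S"
      using orients_insert_edge[OF simple_imp_sym[OF S(1)] orients_S, of u u]
      by (auto simp: S_def v_def intro: orients_subset)
    define h where "h = (\<lambda>x. if (v, x) \<in> S\<^sup>* then g x else (f(u := u)) x)"
    have h: "orients h S" "(v, h v) \<notin> S" "h u = u"
      using orients_merge[OF S(1) orients_S' g(1)] g(2)
        acyclic_component_bridge[OF acyclic True \<open>u \<noteq> v\<close>]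
      by (auto simp: h_def S_def)
    have "orients (h(v := u)) R"
      using orients_insert_edge[OF simple_imp_sym[OF S(1)] h(1,2), of u] orients_subset
      by (fastforce simp: S_def)
    thus ?thesis using h(3) \<open>u \<noteq> v\<close> simple_irrefl[OF R] by (intro exI[of _ "h(v := u)"]) simp
  qed
qed

lemma circuit_unique_Diff_edge:
  assumes R: "simple R" "circuit_unique R" and uv: "(u, v) \<in> R"
  shows "acyclic_component (R - {(u, v), (v, u)}) u \<or> acyclic_component (R - {(u, v), (v, u)}) v"
proof (rule ccontr)
  define S where S_def: "S = R - {(u, v), (v, u)}"
  assume "\<not> ?thesis"
  then obtain C x D y where C: "circuit C" "C \<subseteq> S" "x \<in> Domain C" "(u, x) \<in> S\<^sup>*"
    and D: "circuit D" "D \<subseteq> S" "y \<in> Domain D" "(v, y) \<in> S\<^sup>*"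
    unfolding acyclic_component_def S_def by blast
  have sym_S: "(b, a) \<in> S\<^sup>*" if "(a, b) \<in> S\<^sup>*" for a b
    using simple_rtrancl_sym[OF simple_Diff_edge[OF R(1)]] that unfolding S_def .
  have subset_R: "S \<subseteq> R" "S\<^sup>* \<subseteq> R\<^sup>*" using S_def rtrancl_mono[of S R] by auto
  have "u \<noteq> v" using uv simple_irrefl[OF R(1)] by blast
  have "(x, y) \<in> R\<^sup>*"
    using sym_S[OF C(4)] uv D(4) subset_R by (meson rtrancl_into_rtrancl rtrancl_trans subsetD)
  hence edge_set_eq: "edge_set C = edge_set D"
    using R(2) C(1-3) D(1-3) subset_R(1) unfolding circuit_unique_def by blast
  obtain z where "(y, z) \<in> D" using D(3) by blast
  hence "{y, z} \<in> edge_set C" by (simp add: edge_set_eq mem_edge_set_iff)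
  hence "y \<in> Domain C" using circuit_Domain_eq_Range[OF C(1)] by (auto simp: mem_edge_set_iff)
  hence "(x, y) \<in> S\<^sup>*" using circuit_connected[OF C(1,3)] rtrancl_mono[OF C(2)] by blast
  hence "(v, u) \<in> S\<^sup>*" using sym_S C(4) D(4) by (meson rtrancl_trans)
  then obtain E where E: "circuit E" "(u, v) \<in> E" "E \<subseteq> insert (u, v) S"
    using circuit_through_arc[of v u S] \<open>u \<noteq> v\<close> S_def by blast
  hence "edge_set E = edge_set C"
    using R(2) C subset_R uv unfolding circuit_unique_def by blast
  hence "{u, v} \<in> edge_set C" using E(2) by (simp add: mem_edge_set_iff flip: \<open>edge_set E = _\<close>)
  thus False using C(2) S_def by (auto simp: mem_edge_set_iff)
qed

lemma circuit_unique_imp_orientable: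
  assumes "simple R" "circuit_unique R"
  shows "orientable R"
  using assms
proof (induction "card R" arbitrary: R rule: less_induct)
  case less
  note R = less.prems
  show ?case
  proof (cases "R = {}")
    case True
    thus ?thesis by (simp add: orientable_def orients_def)
  next
    case False
    then obtain u v where uv: "(u, v) \<in> R" by auto
    define S where "S = R - {(u, v), (v, u)}"
    have S: "simple S" "S \<subseteq> R" "card S < card R"
      using simple_Diff_edge[OF R(1)] card_Diff_edge[OF R(1) uv] by (auto simp: S_def)
    obtain f where f: "orients f S"
      using less.hyps[OF S(3,1) circuit_unique_subset[OF R(2) S(2)]] by (auto simp: orientable_def)
    have "orientable R" if "acyclic_component S a" "R \<subseteq> S \<union> {(a, b), (b, a)}" for a b
    proof -
      obtain g where "orients g S" "(a, g a) \<notin> S"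
        using orients_reroot[OF S(1) f \<open>acyclic_component S a\<close>] by blast
      hence "orients (g(a := b)) (S \<union> {(a, b), (b, a)})"
        using simple_imp_sym[OF S(1)] by (intro orients_insert_edge)
      thus ?thesis using that(2) orients_subset unfolding orientable_def by blast
    qed
    thus ?thesis
      using circuit_unique_Diff_edge[OF R uv] unfolding S_def[symmetric] by (auto simp: S_def)
  qed
qed

lemma orientable_iff_circuit_unique: "simple R \<Longrightarrow> orientable R \<longleftrightarrow> circuit_unique R"
  using circuit_unique_imp_orientable orients_imp_circuit_unique unfolding orientable_def by blast

lemma pseudoforest_iff_orientable: "pseudoforest G \<longleftrightarrow> pair_graph G \<and> orientable (parcs G)"
  using orientable_iff_circuit_unique
  unfolding pseudoforest_iff_circuit_unique pair_graph_iff_simple by blast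

section \<open>Degrees\<close>

definition degree :: "'a rel \<Rightarrow> 'a \<Rightarrow> nat" where
  "degree R x = card (R `` {x})"

lemma degree_eq_0_iff: "simple R \<Longrightarrow> degree R x = 0 \<longleftrightarrow> R `` {x} = {}"
  by (simp add: degree_def simple_finite_Image)

lemma Domain_eq_degree: "simple R \<Longrightarrow> Domain R = {x. degree R x \<noteq> 0}"
  by (auto simp: degree_eq_0_iff)

lemma degree_le_2_edge_set_circuit:
  assumes R: "simple R" and deg: "\<And>x. degree R x \<le> 2" and C: "circuit C" "C \<subseteq> R"
    and "c \<in> Domain C"
  shows "edge_set C = edge_set {(x, y) \<in> R. (c, x) \<in> R\<^sup>*}"
proof -
  have arcs: "(x, y) \<in> C \<or> (y, x) \<in> C" if x: "x \<in> Domain C" and xy: "(x, y) \<in> R" for x y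
  proof -
    obtain s p where sp: "(x, s) \<in> C" "(p, x) \<in> C" using x circuit_Domain_eq_Range[OF C(1)] by blast
    hence "{s, p} \<subseteq> R `` {x}" using C(2) simple_symD[OF R] by blast
    moreover have "s \<noteq> p" using sp circuit_asym[OF C(1)] by blast
    hence "card (R `` {x}) \<le> card {s, p}" using deg[of x] by (simp add: degree_def)
    ultimately have "{s, p} = R `` {x}" using simple_finite_Image[OF R] by (intro card_seteq)
    hence "y \<in> {s, p}" using xy by blast
    thus ?thesis using sp by blast
  qed
  have "R `` Domain C \<subseteq> Domain C" using arcs circuit_Domain_eq_Range[OF C(1)] by blast
  hence "R\<^sup>* `` Domain C = Domain C" by (rule Image_closed_trancl)
  hence "{x. (c, x) \<in> R\<^sup>*} \<subseteq> Domain C" using \<open>c \<in> Domain C\<close> by blast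
  moreover have "Domain C \<subseteq> {x. (c, x) \<in> R\<^sup>*}"
    using circuit_connected[OF C(1) \<open>c \<in> Domain C\<close>] rtrancl_mono[OF C(2)] by blast
  ultimately have "{(x, y) \<in> R. (c, x) \<in> R\<^sup>*} = C \<union> C\<inverse>"
    using arcs C(2) circuit_Domain_eq_Range[OF C(1)] simple_symD[OF R] by blast
  moreover have "edge_set (C \<union> C\<inverse>) = edge_set C"
    using edge_set_converse[of C] by (simp add: edge_set_def image_Un)
  ultimately show ?thesis by simp
qed

lemma degree_le_2_imp_circuit_unique:
  assumes R: "simple R" and deg: "\<And>x. degree R x \<le> 2"
  shows "circuit_unique R"
  unfolding circuit_unique_def
proof (intro allI impI, elim conjE)
  fix C D x y
  assume "circuit C" "C \<subseteq> R" "circuit D" "D \<subseteq> R" "x \<in> Domain C" "y \<in> Domain D"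
    and xy: "(x, y) \<in> R\<^sup>*"
  hence "edge_set C = edge_set {(a, b) \<in> R. (x, a) \<in> R\<^sup>*}"
    "edge_set D = edge_set {(a, b) \<in> R. (y, a) \<in> R\<^sup>*}"
    by (intro degree_le_2_edge_set_circuit[OF R deg]; simp)+
  moreover have "(x, a) \<in> R\<^sup>* \<longleftrightarrow> (y, a) \<in> R\<^sup>*" for a
    using xy simple_rtrancl_sym[OF R xy] by (blast intro: rtrancl_trans)
  ultimately show "edge_set C = edge_set D" by simp
qed

lemma degree_le_2_imp_orientable:
  "simple R \<Longrightarrow> (\<And>x. degree R x \<le> 2) \<Longrightarrow> orientable R"
  by (intro circuit_unique_imp_orientable degree_le_2_imp_circuit_unique)

lemma sum_degree:
  assumes "simple R"
  shows "(\<Sum>x \<in> Domain R. degree R x) = card R"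
proof -
  have "R = Sigma (Domain R) (\<lambda>x. R `` {x})" by auto
  moreover have "card (Sigma (Domain R) (\<lambda>x. R `` {x})) = (\<Sum>x \<in> Domain R. card (R `` {x}))"
    using simple_imp_finite[OF assms] simple_finite_Image[OF assms] by (simp add: finite_Domain)
  ultimately show ?thesis by (simp add: degree_def)
qed

lemma card_oriented_le:
  assumes R: "simple R" and f: "orients f R"
  shows "card R \<le> 2 * card (Domain R)"
proof -
  let ?out = "\<lambda>x. (x, f x)" and ?in = "\<lambda>x. (f x, x)"
  have finite: "finite (Domain R)" using simple_imp_finite[OF R] by (rule finite_Domain)
  have "R \<subseteq> ?out ` Domain R \<union> ?in ` Domain R"
    using orientsD[OF f] simple_symD[OF R] by fast
  hence "card R \<le> card (?out ` Domain R \<union> ?in ` Domain R)"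
    using finite by (intro card_mono) auto
  also have "\<dots> \<le> card (?out ` Domain R) + card (?in ` Domain R)" by (rule card_Un_le)
  also have "\<dots> \<le> 2 * card (Domain R)"
    using card_image_le[OF finite, of ?out] card_image_le[OF finite, of ?in] by simp
  finally show ?thesis .
qed

lemma orientable_has_leaf:
  assumes R: "simple R" "orientable R" and w: "3 \<le> degree R w"
  obtains v where "degree R v = 1"
proof -
  have "\<exists>v. degree R v = 1"
  proof (rule ccontr)
    assume none: "\<nexists>v. degree R v = 1"
    have "2 \<le> degree R x" if "x \<in> Domain R" for x
    proof -
      have "degree R x \<noteq> 0" "degree R x \<noteq> 1" using that none Domain_eq_degree[OF R(1)] by auto
      thus ?thesis by linarith
    qed
    moreover have "w \<in> Domain R" using w Domain_eq_degree[OF R(1)] by auto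
    ultimately have "(\<Sum>x \<in> Domain R. 2) < (\<Sum>x \<in> Domain R. degree R x)"
      using w simple_imp_finite[OF R(1)]
      by (intro sum_strict_mono_ex1) (auto simp: finite_Domain intro!: bexI[of _ w])
    thus False
      using card_oriented_le[OF R(1)] R(2) by (force simp: sum_degree[OF R(1)] orientable_def)
  qed
  thus ?thesis using that by blast
qed

section \<open>Switches\<close>

definition alternating :: "'a rel \<Rightarrow> 'a \<Rightarrow> 'a \<Rightarrow> 'a \<Rightarrow> 'a \<Rightarrow> bool" where
  "alternating R a b c d \<longleftrightarrow>
     distinct [a, b, c, d] \<and> (a, b) \<in> R \<and> (c, d) \<in> R \<and> (a, c) \<notin> R \<and> (b, d) \<notin> R"

definition switch_at :: "'a rel \<Rightarrow> 'a \<Rightarrow> 'a \<Rightarrow> 'a \<Rightarrow> 'a \<Rightarrow> 'a rel" where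
  "switch_at R a b c d =
     (R - {(a, b), (b, a), (c, d), (d, c)}) \<union> {(a, c), (c, a), (b, d), (d, b)}"

definition switch :: "'a rel \<Rightarrow> 'a rel \<Rightarrow> bool" where
  "switch R S \<longleftrightarrow> (\<exists>a b c d. alternating R a b c d \<and> S = switch_at R a b c d)"

lemma alternating_sym:
  assumes "simple R" "alternating R a b c d"
  shows "alternating R b a d c" "alternating R c d a b" "alternating R d c b a"
  using assms(2) simple_symD[OF assms(1)] unfolding alternating_def by auto

lemma switch_at_sym:
  "switch_at R b a d c = switch_at R a b c d" "switch_at R c d a b = switch_at R a b c d"
  "switch_at R d c b a = switch_at R a b c d"
  by (auto simp: switch_at_def)

lemma simple_switch:
  assumes "switch R S" "simple R"
  shows "simple S"
proof -
  obtain a b c d where "alternating R a b c d" "S = switch_at R a b c d"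
    using assms(1) unfolding switch_def by blast
  thus ?thesis
    using assms(2) by (auto simp: simple_def sym_def irrefl_def alternating_def switch_at_def)
qed

lemma switch_sym:
  assumes "switch R S" "simple R"
  shows "switch S R"
proof -
  obtain a b c d where abcd: "alternating R a b c d" and S: "S = switch_at R a b c d"
    using assms(1) unfolding switch_def by blast
  have "alternating S a c b d" using abcd by (auto simp: S alternating_def switch_at_def)
  moreover have "R = switch_at S a c b d"
    using abcd alternating_sym[OF assms(2) abcd]
    by (auto simp: S alternating_def switch_at_def)
  ultimately show ?thesis unfolding switch_def by blast
qed

lemma degree_switch_at:
  assumes "simple R" "alternating R a b c d"
  shows "degree (switch_at R a b c d) a = degree R a"
proof -
  have "switch_at R a b c d `` {a} = insert c (R `` {a} - {b})"
    using assms(2) by (auto simp: alternating_def switch_at_def)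
  moreover have "card (insert c (R `` {a} - {b})) = Suc (card (R `` {a} - {b}))"
    using assms(2) simple_finite_Image[OF assms(1)] by (simp add: alternating_def)
  moreover have "\<dots> = card (R `` {a})"
    using assms(2) simple_finite_Image[OF assms(1)]
    by (intro card_Suc_Diff1) (auto simp: alternating_def)
  ultimately show ?thesis by (simp add: degree_def)
qed

lemma degree_switch:
  assumes "switch R S" and R: "simple R"
  shows "degree S = degree R"
proof
  fix x
  obtain a b c d where abcd: "alternating R a b c d" and S: "S = switch_at R a b c d"
    using assms(1) unfolding switch_def by blast
  show "degree S x = degree R x"
  proof (cases "x \<in> {a, b, c, d}")
    case True
    moreover note degree_switch_at[OF R abcd]
      alternating_sym[OF R abcd, THEN degree_switch_at[OF R]]
    ultimately show ?thesis by (auto simp: S switch_at_sym)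
  next
    case False
    hence "S `` {x} = R `` {x}" by (auto simp: S switch_at_def)
    thus ?thesis by (simp add: degree_def)
  qed
qed

definition linked :: "('a rel \<Rightarrow> bool) \<Rightarrow> 'a rel \<Rightarrow> 'a rel \<Rightarrow> bool" where
  "linked P = (\<lambda>R S. switch R S \<and> P S)\<^sup>*\<^sup>*"

lemma linked_refl: "linked P R R"
  by (simp add: linked_def)

lemma switch_imp_linked: "switch R S \<Longrightarrow> P S \<Longrightarrow> linked P R S"
  unfolding linked_def by blast

lemma linked_trans [trans]: "linked P R S \<Longrightarrow> linked P S T \<Longrightarrow> linked P R T"
  unfolding linked_def by (rule rtranclp_trans)

lemma linked_induct [consumes 2, case_names refl switch]:
  assumes "linked P R S" "simple R" "Q R"
    and "\<And>T U. simple T \<Longrightarrow> degree T = degree R \<Longrightarrow> linked P R T \<Longrightarrow> Q T \<Longrightarrow>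
       switch T U \<Longrightarrow> simple U \<Longrightarrow> degree U = degree R \<Longrightarrow> P U \<Longrightarrow> Q U"
  shows "Q S"
proof -
  have "simple S \<and> degree S = degree R \<and> linked P R S \<and> Q S"
    using assms(1) unfolding linked_def
  proof (induction rule: rtranclp_induct)
    case (step T U)
    hence "simple U" "degree U = degree R"
      using simple_switch[of T U] degree_switch[of T U] by simp_all
    moreover from this have "Q U" using assms(4)[of T U] step by (simp add: linked_def)
    ultimately show ?case using step by (auto intro: rtranclp.rtrancl_into_rtrancl)
  qed (use assms in simp)
  thus ?thesis by simp
qed

lemma
  assumes "linked P R S" "simple R"
  shows linked_imp_simple: "simple S"
    and linked_imp_degree_eq: "degree S = degree R"
    and linked_imp_invariant: "P R \<Longrightarrow> P S"
proof -
  show "simple S" using assms by (induction rule: linked_induct) (use assms(2) in auto)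
  show "degree S = degree R" using assms by (induction rule: linked_induct) auto
  show "P R \<Longrightarrow> P S" using assms by (induction rule: linked_induct) auto
qed

lemma linked_mono:
  assumes "linked P R S" "simple R"
    and "\<And>T. simple T \<Longrightarrow> degree T = degree R \<Longrightarrow> P T \<Longrightarrow> Q T"
  shows "linked Q R S"
  using assms(1,2)
proof (induction rule: linked_induct)
  case (switch T U)
  hence "linked Q T U" using assms(3)[of U] by (intro switch_imp_linked)
  with switch.IH show ?case by (rule linked_trans)
qed (rule linked_refl)

lemma linked_sym:
  assumes "linked P R S" "simple R" "P R"
  shows "linked P S R"
  using assms(1,2)
proof (induction rule: linked_induct)
  case (switch T U)
  have "P T" using linked_imp_invariant[OF switch.hyps(3) assms(2,3)] .
  hence "linked P U T" using switch_sym[OF switch.hyps(4,1)] by (intro switch_imp_linked)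
  thus ?case using switch.IH by (rule linked_trans)
qed (rule linked_refl)

lemma exchange_neighbour:
  assumes R: "simple R" and w: "(v, w) \<in> R" and u: "(v, u) \<notin> R" "u \<noteq> v"
    and deg: "degree R w \<le> degree R u"
  obtains R' where "switch R R'" "R' `` {v} = insert u (R `` {v} - {w})"
proof -
  have "\<not> R `` {u} - {w} \<subset> R `` {w} - {u}"
  proof
    assume "R `` {u} - {w} \<subset> R `` {w} - {u}"
    hence "card (R `` {u} - {w}) < card (R `` {w} - {u})"
      by (intro psubset_card_mono) (simp_all add: simple_finite_Image[OF R])
    moreover have "w \<in> R `` {u} \<longleftrightarrow> u \<in> R `` {w}" using simple_symD[OF R] by blast
    ultimately show False
      using deg by (auto simp: degree_def card_Diff_singleton_if split: if_splits)
  qed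
  moreover have "v \<in> R `` {w} - {u}" "v \<notin> R `` {u}" using w u simple_symD[OF R] by auto
  ultimately obtain x where x: "(u, x) \<in> R" "x \<noteq> w" "(w, x) \<notin> R"
    using simple_irrefl[OF R] by blast
  have distinct: "distinct [v, w, u, x]"
    using u w x simple_symD[OF R] simple_irrefl[OF R] by auto
  show ?thesis
  proof
    show "switch R (switch_at R v w u x)"
      unfolding switch_def alternating_def using distinct w u x by blast
    show "switch_at R v w u x `` {v} = insert u (R `` {v} - {w})"
      using distinct by (auto simp: switch_at_def)
  qed
qed

definition common_degree :: "'a rel \<Rightarrow> 'a rel \<Rightarrow> 'a \<Rightarrow> nat" where
  "common_degree R S v = card (R `` {v} \<inter> S `` {v})"

lemma common_degree_le: "simple R \<Longrightarrow> common_degree R S v \<le> degree R v"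
  unfolding common_degree_def degree_def by (simp add: card_mono simple_finite_Image)

lemma switch_increases_common_degree:
  assumes R: "simple R" and S: "simple S" and deg: "degree R = degree S"
    and "R `` {v} \<noteq> S `` {v}"
  shows "(\<exists>R'. switch R R' \<and> common_degree R S v < common_degree R' S v) \<or>
    (\<exists>S'. switch S S' \<and> common_degree R S v < common_degree R S' v)"
proof -
  have finite: "finite (R `` {v})" "finite (S `` {v})"
    using simple_finite_Image R S by blast+
  moreover have "card (R `` {v}) = card (S `` {v})" using deg by (metis degree_def)
  ultimately have "\<not> R `` {v} \<subseteq> S `` {v}" "\<not> S `` {v} \<subseteq> R `` {v}"
    using \<open>R `` {v} \<noteq> S `` {v}\<close> by (metis card_subset_eq)+
  then obtain w u where w: "(v, w) \<in> R" "(v, w) \<notin> S" and u: "(v, u) \<in> S" "(v, u) \<notin> R" by blast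
  have "u \<noteq> v" "w \<noteq> v" using u w simple_irrefl[OF R] simple_irrefl[OF S] by blast+
  have card_less: "card (R `` {v} \<inter> S `` {v}) < card (insert y (R `` {v} \<inter> S `` {v}))"
    if "y \<notin> R `` {v} \<inter> S `` {v}" for y
    using that finite by simp
  consider (in_R) "degree R w \<le> degree R u" | (in_S) "degree S u \<le> degree S w"
    using deg by fastforce
  thus ?thesis
  proof cases
    case in_R
    then obtain R' where R': "switch R R'" "R' `` {v} = insert u (R `` {v} - {w})"
      using exchange_neighbour[OF R w(1) u(2) \<open>u \<noteq> v\<close>] by blast
    hence "R' `` {v} \<inter> S `` {v} = insert u (R `` {v} \<inter> S `` {v})" using w u by auto
    thus ?thesis using R'(1) card_less[of u] u unfolding common_degree_def by auto
  next
    case in_S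
    then obtain S' where S': "switch S S'" "S' `` {v} = insert w (S `` {v} - {u})"
      using exchange_neighbour[OF S u(1) w(2) \<open>w \<noteq> v\<close>] by blast
    hence "R `` {v} \<inter> S' `` {v} = insert w (R `` {v} \<inter> S `` {v})" using w u by auto
    thus ?thesis using S'(1) card_less[of w] w unfolding common_degree_def by auto
  qed
qed

lemma align_neighbours:
  assumes "simple R" "simple S" "degree R = degree S"
  shows "\<exists>R' S'. linked (\<lambda>_. True) R R' \<and> linked (\<lambda>_. True) S S' \<and> R' `` {v} = S' `` {v}"
  using assms
proof (induction "degree R v - common_degree R S v" arbitrary: R S rule: less_induct)
  case less
  note R = less.prems(1) and S = less.prems(2) and deg = less.prems(3)
  show ?case
  proof (cases "R `` {v} = S `` {v}")
    case True
    thus ?thesis using linked_refl by blast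
  next
    case False
    from switch_increases_common_degree[OF R S deg False] show ?thesis
    proof (elim disjE exE conjE)
      fix R' assume R': "switch R R'" "common_degree R S v < common_degree R' S v"
      note simple' = simple_switch[OF R'(1) R] and degree' = degree_switch[OF R'(1) R]
      have "degree R' v - common_degree R' S v < degree R v - common_degree R S v"
        using R'(2) degree' common_degree_le[OF simple', of S v] by simp
      moreover have "degree R' = degree S" using deg degree' by simp
      moreover have "linked (\<lambda>_. True) R R'" using R'(1) by (rule switch_imp_linked) simp
      ultimately show ?thesis using less.hyps[OF _ simple' S] linked_trans by blast
    next
      fix S' assume S': "switch S S'" "common_degree R S v < common_degree R S' v"
      note simple' = simple_switch[OF S'(1) S] and degree' = degree_switch[OF S'(1) S]
      have "degree R v - common_degree R S' v < degree R v - common_degree R S v"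
        using S'(2) common_degree_le[OF R, of S' v] by simp
      moreover have "degree R = degree S'" using deg degree' by simp
      moreover have "linked (\<lambda>_. True) S S'" using S'(1) by (rule switch_imp_linked) simp
      ultimately show ?thesis using less.hyps[OF _ R simple'] linked_trans by blast
    qed
  qed
qed

lemma neighbour_oriented_towards:
  assumes R: "simple R" and f: "orients f R" and w: "3 \<le> degree R w" and "u \<noteq> w"
  obtains x where "(w, x) \<in> R" "f x = w" "x \<noteq> u" "(u, x) \<notin> R"
proof -
  define X where "X = {x \<in> R `` {w}. f x = w}"
  have "finite X"
    using simple_finite_Image[OF R, of "{w}"] by (rule rev_finite_subset) (auto simp: X_def)
  have "R `` {w} \<subseteq> insert (f w) X" using orientsD[OF f] by (auto simp: X_def)
  hence "degree R w \<le> card (insert (f w) X)"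
    using \<open>finite X\<close> unfolding degree_def by (intro card_mono) auto
  hence "2 \<le> card X" using w \<open>finite X\<close> by (auto simp: card_insert_if split: if_splits)
  have "\<not> X \<subseteq> {u, f u}"
  proof
    assume "X \<subseteq> {u, f u}"
    moreover have "w \<notin> X" using simple_irrefl[OF R] by (auto simp: X_def)
    hence "u \<notin> X \<or> f u \<notin> X" by (auto simp: X_def)
    ultimately have "X \<subseteq> {u} \<or> X \<subseteq> {f u}" by blast
    hence "card X \<le> 1" using card_mono[of "{u}" X] card_mono[of "{f u}" X] by auto
    thus False using \<open>2 \<le> card X\<close> by simp
  qed
  then obtain x where x: "(w, x) \<in> R" "f x = w" "x \<noteq> u" "x \<noteq> f u" by (auto simp: X_def)
  moreover have "(u, x) \<notin> R" using orientsD[OF f] x \<open>u \<noteq> w\<close> by blast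
  ultimately show ?thesis by (intro that)
qed

lemma move_leaf:
  assumes R: "simple R" "orientable R" and v: "R `` {v} = {u}" and w: "3 \<le> degree R w"
  obtains R' where "linked orientable R R'" "R' `` {v} = {w}"
proof (cases "u = w")
  case True
  thus ?thesis using that linked_refl v by blast
next
  case False
  obtain f where f: "orients f R" using R(2) by (auto simp: orientable_def)
  obtain x where x: "(w, x) \<in> R" "f x = w" "x \<noteq> u" "(u, x) \<notin> R"
    using neighbour_oriented_towards[OF R(1) f w False] .
  have leaf: "(v, y) \<in> R \<longleftrightarrow> y = u" "(y, v) \<in> R \<longleftrightarrow> y = u" for y
    using v simple_symD[OF R(1)] by blast+
  have "v \<noteq> w" using v w by (auto simp: degree_def)
  hence distinct: "distinct [v, u, w, x]"
    using False x leaf simple_irrefl[OF R(1)] by auto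
  define R' where "R' = switch_at R v u w x"
  have "alternating R v u w x" using distinct leaf False x(1,4) by (simp add: alternating_def)
  hence switch: "switch R R'" unfolding switch_def R'_def by blast
  \<comment> \<open>\<open>v\<close> and \<open>x\<close> receive no edge among those that the switch keeps, so they can take the new ones.\<close>
  define S where "S = R - {(v, u), (u, v), (w, x), (x, w)}"
  have S: "sym S" "orients f S" "(v, f v) \<notin> S" "(x, w) \<notin> S"
    using simple_imp_sym[OF R(1)] orients_subset[OF f] leaf by (auto simp: S_def sym_def)
  define g where "g = f(v := w)"
  have g: "orients g (S \<union> {(v, w), (w, v)})"
    unfolding g_def using S(1-3) by (rule orients_insert_edge)
  have "sym (S \<union> {(v, w), (w, v)})" "(x, g x) \<notin> S \<union> {(v, w), (w, v)}"
    using S(1,4) distinct x(2) by (auto simp: g_def sym_def)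
  hence "orients (g(x := u)) (S \<union> {(v, w), (w, v)} \<union> {(x, u), (u, x)})"
    using g by (intro orients_insert_edge)
  moreover have "R' = S \<union> {(v, w), (w, v)} \<union> {(x, u), (u, x)}"
    by (auto simp: R'_def S_def switch_at_def)
  ultimately have "orientable R'" unfolding orientable_def by auto
  with switch have "linked orientable R R'" by (rule switch_imp_linked)
  moreover have "R' `` {v} = {w}" using v distinct by (auto simp: R'_def switch_at_def)
  ultimately show ?thesis by (rule that)
qed

section \<open>Deleting a vertex\<close>

definition attach :: "'a \<Rightarrow> 'a set \<Rightarrow> 'a rel \<Rightarrow> 'a rel" where
  "attach v N R = R \<union> {v} \<times> N \<union> N \<times> {v}"

definition delete :: "'a \<Rightarrow> 'a rel \<Rightarrow> 'a rel" where
  "delete v R = {(x, y) \<in> R. x \<noteq> v \<and> y \<noteq> v}"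

lemma attach_delete: "sym R \<Longrightarrow> attach v (R `` {v}) (delete v R) = R"
  by (auto simp: attach_def delete_def dest: symD)

lemma delete_subset: "delete v R \<subseteq> R"
  by (auto simp: delete_def)

lemma Image_delete: "delete v R `` {v} = {}"
  by (auto simp: delete_def)

lemma simple_delete: "simple R \<Longrightarrow> simple (delete v R)"
  unfolding simple_def
  by (auto simp: delete_def sym_def irrefl_def intro: finite_subset[of _ R])

lemma simple_attach: "simple R \<Longrightarrow> finite N \<Longrightarrow> v \<notin> N \<Longrightarrow> simple (attach v N R)"
  by (auto simp: simple_def attach_def sym_def irrefl_def)

lemma degree_attach:
  assumes R: "simple R" "R `` {v} = {}" and N: "v \<notin> N"
  shows "degree (attach v N R) x = (if x = v then card N else degree R x + of_bool (x \<in> N))"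
proof (cases "x = v")
  case True
  hence "attach v N R `` {x} = N" using R(2) N by (auto simp: attach_def)
  thus ?thesis using True by (simp add: degree_def)
next
  case False
  have "attach v N R `` {x} = (if x \<in> N then insert v (R `` {x}) else R `` {x})"
    using False N by (auto simp: attach_def)
  moreover have "v \<notin> R `` {x}" using R(2) simple_symD[OF R(1)] by blast
  ultimately show ?thesis using False simple_finite_Image[OF R(1)] by (simp add: degree_def)
qed

lemma degree_delete:
  assumes "simple R"
  shows "degree (delete v R) x = (if x = v then 0 else degree R x - of_bool ((v, x) \<in> R))"
proof (cases "x = v")
  case True
  thus ?thesis by (simp add: degree_def Image_delete)
next
  case False
  have "degree R x = degree (attach v (R `` {v}) (delete v R)) x"
    by (simp add: attach_delete simple_imp_sym[OF assms])
  also have "\<dots> = degree (delete v R) x + of_bool ((v, x) \<in> R)"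
    using False simple_delete[OF assms] simple_irrefl[OF assms]
    by (simp add: degree_attach Image_delete)
  finally show ?thesis using False by simp
qed

lemma degree_delete_cong:
  assumes "simple R" "simple S" "degree R = degree S" "R `` {v} = S `` {v}"
  shows "degree (delete v R) = degree (delete v S)"
proof
  fix x
  have "(v, x) \<in> R \<longleftrightarrow> (v, x) \<in> S" using assms(4) by blast
  thus "degree (delete v R) x = degree (delete v S) x"
    using assms(1-3) by (simp add: degree_delete)
qed

lemma card_Domain_delete:
  assumes "simple R" "R `` {v} \<noteq> {}"
  shows "card (Domain (delete v R)) < card (Domain R)"
proof (rule psubset_card_mono)
  show "finite (Domain R)" using assms by (simp add: simple_def finite_Domain)
  show "Domain (delete v R) \<subset> Domain R" using assms by (auto simp: delete_def)
qed

lemma switch_attach: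
  assumes "switch R S" "simple R" and v: "R `` {v} = {}"
  shows "switch (attach v N R) (attach v N S)"
proof -
  obtain a b c d where abcd: "alternating R a b c d" and S: "S = switch_at R a b c d"
    using assms(1) unfolding switch_def by blast
  have "v \<notin> {a, b, c, d}"
    using abcd alternating_sym[OF assms(2) abcd] v unfolding alternating_def by blast
  hence "alternating (attach v N R) a b c d" "attach v N S = switch_at (attach v N R) a b c d"
    using abcd by (auto simp: S alternating_def switch_at_def attach_def)
  thus ?thesis unfolding switch_def by blast
qed

lemma linked_attach:
  assumes "linked P R S" "simple R" and v: "R `` {v} = {}"
    and PQ: "\<And>T. simple T \<Longrightarrow> degree T = degree R \<Longrightarrow> P T \<Longrightarrow> Q (attach v N T)"
  shows "linked Q (attach v N R) (attach v N S)"
  using assms(1,2)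
proof (induction rule: linked_induct)
  case (switch T U)
  have "T `` {v} = {}" using v switch.hyps(1,2) assms(2) by (metis degree_eq_0_iff)
  hence "switch (attach v N T) (attach v N U)" using switch_attach[OF switch.hyps(4,1)] by simp
  hence "linked Q (attach v N T) (attach v N U)"
    using PQ[OF switch.hyps(5-7)] by (rule switch_imp_linked)
  with switch.IH show ?case by (rule linked_trans)
qed (rule linked_refl)

definition removable :: "('a rel \<Rightarrow> bool) \<Rightarrow> 'a \<Rightarrow> 'a rel \<Rightarrow> bool" where
  "removable P v R \<longleftrightarrow>
     (\<forall>T. simple T \<and> degree T = degree (delete v R) \<and> P T \<longrightarrow> P (attach v (R `` {v}) T))"

lemma linked_via_delete:
  assumes R: "simple R" and S: "simple S" and same_neighbours: "R `` {v} = S `` {v}"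
    and "removable P v R" "linked P (delete v R) (delete v S)"
  shows "linked P R S"
proof -
  have "linked P (attach v (R `` {v}) (delete v R)) (attach v (R `` {v}) (delete v S))"
    using assms(5) simple_delete[OF R] Image_delete
    by (rule linked_attach) (use assms(4) in \<open>simp add: removable_def\<close>)
  thus ?thesis
    using attach_delete[OF simple_imp_sym[OF R], of v] attach_delete[OF simple_imp_sym[OF S], of v]
      same_neighbours by simp
qed

lemma leaf_removable:
  assumes "simple R" "R `` {v} = {w}"
  shows "removable orientable v R"
  unfolding removable_def
proof (intro allI impI, elim conjE)
  fix T assume T: "simple T" "degree T = degree (delete v R)" "orientable T"
  then obtain f where f: "orients f T" by (auto simp: orientable_def)
  have "T `` {v} = {}"
    using T(1,2) degree_delete[OF assms(1), of v v] by (simp flip: degree_eq_0_iff)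
  hence "orients (f(v := w)) (T \<union> {(v, w), (w, v)})"
    using f simple_imp_sym[OF T(1)] by (intro orients_insert_edge) auto
  moreover have "attach v (R `` {v}) T = T \<union> {(v, w), (w, v)}"
    unfolding assms(2) by (auto simp: attach_def)
  ultimately show "orientable (attach v (R `` {v}) T)" by (auto simp: orientable_def)
qed

lemma degree_le_2_removable:
  assumes R: "simple R" and deg: "\<And>x. degree R x \<le> 2"
  shows "removable orientable v R"
  unfolding removable_def
proof (intro allI impI, elim conjE)
  fix T assume T: "simple T" "degree T = degree (delete v R)"
  let ?A = "attach v (R `` {v})"
  have isolated: "T `` {v} = {}" "delete v R `` {v} = {}"
    using T degree_delete[OF R, of v v] by (simp_all add: Image_delete flip: degree_eq_0_iff)
  have v: "v \<notin> R `` {v}" using simple_irrefl[OF R] by simp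
  have "degree (?A T) x = degree (?A (delete v R)) x" for x
    using T isolated v simple_delete[OF R] by (simp add: degree_attach)
  hence "degree (?A T) x \<le> 2" for x
    using deg by (simp add: attach_delete simple_imp_sym[OF R])
  moreover have "simple (?A T)" using T(1) v simple_finite_Image[OF R] by (intro simple_attach)
  ultimately show "orientable (?A T)" by (rule degree_le_2_imp_orientable[rotated])
qed

lemma orientable_align:
  assumes R: "simple R" "orientable R" and S: "simple S" "orientable S"
    and deg: "degree R = degree S" and nonempty: "R \<noteq> {}"
  obtains R' S' v where "linked orientable R R'" "linked orientable S S'" "R' `` {v} = S' `` {v}"
    "R' `` {v} \<noteq> {}" "removable orientable v R'"
proof (cases "\<forall>x. degree R x \<le> 2")
  case True
  obtain v where v: "degree R v \<noteq> 0" using nonempty by (fastforce simp: degree_eq_0_iff[OF R(1)])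
  obtain R' S' where R'S': "linked (\<lambda>_. True) R R'" "linked (\<lambda>_. True) S S'" "R' `` {v} = S' `` {v}"
    using align_neighbours[OF R(1) S(1) deg] by blast
  have orientable: "orientable T" if "simple T" "degree T = degree R" for T
    using that True by (intro degree_le_2_imp_orientable) simp_all
  have "linked orientable R R'" "linked orientable S S'"
    using linked_mono[OF R'S'(1) R(1)] linked_mono[OF R'S'(2) S(1)] orientable deg by simp_all
  moreover note R' = linked_imp_simple[OF R'S'(1) R(1)] linked_imp_degree_eq[OF R'S'(1) R(1)]
  have "R' `` {v} \<noteq> {}" using v R' by (simp flip: degree_eq_0_iff)
  moreover have "removable orientable v R'"
    using True R' by (intro degree_le_2_removable) simp_all
  ultimately show ?thesis using R'S'(3) that by blast
next
  case False
  then obtain w where "\<not> degree R w \<le> 2" by blast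
  hence w: "3 \<le> degree R w" "3 \<le> degree S w" using deg by simp_all
  obtain v where "degree R v = 1" using orientable_has_leaf[OF R w(1)] .
  then obtain u u' where "R `` {v} = {u}" "S `` {v} = {u'}"
    using deg by (metis degree_def card_1_singletonE)
  then obtain R' S' where R': "linked orientable R R'" "R' `` {v} = {w}"
    and S': "linked orientable S S'" "S' `` {v} = {w}"
    using move_leaf[OF R _ w(1)] move_leaf[OF S _ w(2)] by metis
  moreover have "removable orientable v R'"
    using leaf_removable[OF linked_imp_simple[OF R'(1) R(1)] R'(2)] .
  ultimately show ?thesis by (intro that[of R' S' v]) simp_all
qed

lemma orientable_linked:
  assumes "simple R" "orientable R" "simple S" "orientable S" "degree R = degree S"
  shows "linked orientable R S"
  using assms
proof (induction "card (Domain R)" arbitrary: R S rule: less_induct)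
  case less
  note R = less.prems(1,2) and S = less.prems(3,4) and deg = less.prems(5)
  show ?case
  proof (cases "R = {}")
    case True
    hence "Domain S = {}" using Domain_eq_degree[OF R(1)] Domain_eq_degree[OF S(1)] deg by simp
    hence "S = {}" by (simp add: Domain_empty_iff)
    thus ?thesis using True linked_refl by blast
  next
    case False
    obtain R' S' v where RR': "linked orientable R R'" and SS': "linked orientable S S'"
      and neighbours: "R' `` {v} = S' `` {v}" "R' `` {v} \<noteq> {}" and v: "removable orientable v R'"
      using orientable_align[OF R S deg False] .
    note simple' = linked_imp_simple[OF RR' R(1)] linked_imp_simple[OF SS' S(1)]
      and degree' = linked_imp_degree_eq[OF RR' R(1)] linked_imp_degree_eq[OF SS' S(1)]
      and orientable' = linked_imp_invariant[OF RR' R] linked_imp_invariant[OF SS' S]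
    have smaller: "card (Domain (delete v R')) < card (Domain R)"
      using card_Domain_delete[OF simple'(1) neighbours(2)] simple'(1) degree'(1) R(1)
      by (simp add: Domain_eq_degree)
    have "orientable (delete v R')" "orientable (delete v S')"
      using orientable' by (simp_all add: orientable_subset[OF _ delete_subset])
    moreover have "degree (delete v R') = degree (delete v S')"
      using degree_delete_cong[OF simple' _ neighbours(1)] degree' deg by simp
    ultimately have "linked orientable (delete v R') (delete v S')"
      using less.hyps[OF smaller] simple'[THEN simple_delete] by simp
    hence "linked orientable R' S'" by (rule linked_via_delete[OF simple' neighbours(1) v])
    also have "linked orientable S' S" using linked_sym[OF SS' S] .
    finally show ?thesis by (rule linked_trans[OF RR'])
  qed
qed

section \<open>Realizations\<close>

lemma two_switch_iff:
  "two_switch G H \<longleftrightarrow> pverts H = pverts G \<and> switch (parcs G) (parcs H)"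
  unfolding two_switch_def switch_def alternating_def switch_at_def by (cases H) auto

lemma out_degree_with_proj: "out_degree (with_proj G) v = degree (parcs G) v"
proof -
  have "out_arcs (with_proj G) v = Pair v ` (parcs G `` {v})" by (auto simp: out_arcs_def)
  thus ?thesis by (simp add: out_degree_def degree_def card_image inj_on_def)
qed

lemma realizations_iff:
  "G \<in> realizations n d \<longleftrightarrow> pverts G = {1..n} \<and> simple (parcs G) \<and>
     degree (parcs G) = (\<lambda>v. if v \<in> {1..n} then d v else 0)"
proof -
  have "parcs G \<subseteq> {1..n} \<times> {1..n} \<longleftrightarrow> (\<forall>v. v \<notin> {1..n} \<longrightarrow> degree (parcs G) v = 0)"
    if "simple (parcs G)"
    using simple_symD[OF that] by (fastforce simp: degree_eq_0_iff[OF that])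
  thus ?thesis
    by (auto simp: realizations_def pair_graph_iff_simple out_degree_with_proj fun_eq_iff)
qed

lemma realizations_two_switch:
  "G \<in> realizations n d \<Longrightarrow> two_switch G H \<Longrightarrow> H \<in> realizations n d"
  using simple_switch[of "parcs G" "parcs H"] degree_switch[of "parcs G" "parcs H"]
  by (simp add: realizations_iff two_switch_iff)

lemma linked_imp_two_switches:
  assumes "linked orientable (parcs G) R" "G \<in> realizations n d"
  shows "(\<lambda>G' H'. two_switch G' H' \<and> pseudoforest H')\<^sup>*\<^sup>* G (G\<lparr>parcs := R\<rparr>)"
proof -
  have "simple (parcs G)" using assms(2) by (simp add: realizations_iff)
  with assms(1) show ?thesis
  proof (induction rule: linked_induct)
    case (switch S T)
    hence "G\<lparr>parcs := T\<rparr> \<in> realizations n d" using assms(2) by (simp add: realizations_iff)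
    hence "pair_graph (G\<lparr>parcs := T\<rparr>)" unfolding realizations_def by blast
    hence "pseudoforest (G\<lparr>parcs := T\<rparr>)"
      using switch.hyps by (simp add: pseudoforest_iff_orientable)
    moreover have "two_switch (G\<lparr>parcs := S\<rparr>) (G\<lparr>parcs := T\<rparr>)"
      using switch.hyps by (simp add: two_switch_iff)
    ultimately show ?case using switch.IH by (auto intro: rtranclp.rtrancl_into_rtrancl)
  qed simp
qed

lemma pseudoforests_linked:
  assumes G: "G \<in> realizations n d" "pseudoforest G" and H: "H \<in> realizations n d" "pseudoforest H"
  shows "(\<lambda>G' H'. two_switch G' H' \<and> pseudoforest H')\<^sup>*\<^sup>* G H" (is "?step\<^sup>*\<^sup>* G H")
proof -
  have "linked orientable (parcs G) (parcs H)"
    using G H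
    by (intro orientable_linked) (simp_all add: realizations_iff pseudoforest_iff_orientable)
  hence "?step\<^sup>*\<^sup>* G (G\<lparr>parcs := parcs H\<rparr>)" using G(1) by (rule linked_imp_two_switches)
  moreover have "G\<lparr>parcs := parcs H\<rparr> = H"
    using G(1) H(1) by (cases G; cases H) (simp add: realizations_iff)
  ultimately show ?thesis by simp
qed

lemma connected_pseudoforest_graph:
  assumes "verts (pseudoforest_graph n d) \<noteq> {}"
  shows "connected (pseudoforest_graph n d)"
proof (rule strongly_connected_imp_connected, rule strongly_connectedI)
  let ?P = "pseudoforest_graph n d"
  have verts: "verts ?P = {G \<in> realizations n d. pseudoforest G}"
    by (simp add: pseudoforest_graph_def)
  fix G H assume G: "G \<in> verts ?P" and H: "H \<in> verts ?P"
  have "(\<lambda>G' H'. two_switch G' H' \<and> pseudoforest H')\<^sup>*\<^sup>* G H"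
    using G H by (intro pseudoforests_linked) (auto simp: verts)
  thus "G \<rightarrow>\<^sup>*\<^bsub>?P\<^esub> H"
  proof (induction rule: rtranclp_induct)
    case base
    show ?case using G by (simp add: reachable_def)
  next
    case (step K L)
    have "K \<in> verts ?P" using step.IH by (auto dest: reachable_in_vertsE)
    moreover from this have "L \<in> verts ?P"
      using step realizations_two_switch by (auto simp: verts)
    ultimately have "(K, L) \<in> arcs_ends ?P"
      using step unfolding arcs_ends_conv
      by (auto simp: pseudoforest_graph_def realization_graph_def induce_subgraph_def image_iff)
    with step.IH show ?case
      using \<open>L \<in> verts ?P\<close> unfolding reachable_def by (rule rtrancl_on_into_rtrancl_on)
  qed
qed (fact assms)

theorem mainTheorem3:
  fixes n :: nat and d :: "nat \<Rightarrow> nat"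
  assumes "degree_sequence n d"
  shows "(verts (pseudoforest_graph n d) \<noteq> {} \<longrightarrow> connected (pseudoforest_graph n d)) \<and>
    (\<forall>G \<in> realizations n d. \<forall>H \<in> realizations n d. pseudoforest G \<longrightarrow> pseudoforest H \<longrightarrow>
      (\<lambda>G' H'. two_switch G' H' \<and> pseudoforest H')\<^sup>*\<^sup>* G H)"
  using connected_pseudoforest_graph pseudoforests_linked by blast

end
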